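(* Let $(Y,\|\cdot\|)$ be a nonzero Banach space and $K\subseteq Y$ a closed, convex and pointed cone with nonempty interior, and assume that either $Y$ is reflexive or $K$ is normal. Then $$\Omega_{GW}\subseteq\Omega_{HU}\subseteq\Omega_{DS}.$$ Moreover, these inclusions are in general strict: there exist a nonzero Banach space $Y$ and a closed, convex and pointed cone $K\subseteq Y$ with nonempty interior, with either $Y$ reflexive or $K$ normal, for which $\Omega_{GW}\subsetneq\Omega_{HU}\subsetneq\Omega_{DS}$.
   Context: Spaces are real; $Y^*$ is the topological dual. A cone is a set $C$ with $tx\in C$ for all $x\in C$, $t\ge 0$. $K^*=\{y^*\in Y^*:\langle y^*,y\rangle\ge 0\ \forall y\in K\}$. The cone $K$ is normal if there is a neighborhood base $\{V_\alpha\}_{\alpha\in T}$ of $0$ in $Y$ with $V_\alpha=(V_\alpha+K)\cap(V_\alpha-K)$ for all $\alpha$. The following are sets of functionals $Y\to\mathbb{R}$ (depending on $Y$ and $K$). $\Omega_{GW}$ is the set of all $\Psi_r$, $r\in\operatorname{int}(K)$, where $\Psi_r(y):=\min\{t\in\mathbb{R}:tr\in y+K\}$. $\Omega_{HU}$ is the set of all $\Psi_{\|\cdot\|'}$, where $\|\cdot\|'$ ranges over the norms on $Y$ equivalent to $\|\cdot\|$ and $\Psi_{\|\cdot\|'}(y):=d(y,-K)-d(y,Y\setminus(-K))$, with $d$ the distance to a set with respect to $\|\cdot\|'$. $\Omega_{DS}$ is the set of all $\Psi_G$, where $G$ ranges over the $w^*$-compact generators of $K^*$ and $\Psi_G(y):=\max\{\langle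 y^*,y\rangle:y^*\in G\}$. Here $G\subseteq Y^*$ is a generator of $K^*$ if $G$ is convex, $0$ is not in the $w^*$-closure of $G$, and $K^*=\{ty^*:t\ge 0,\ y^*\in G\}$. *)

theory Defs
  imports "HOL-Analysis.Analysis"
begin

definition pointed :: "'a::real_vector set \<Rightarrow> bool" where
  "pointed K \<longleftrightarrow> K \<inter> uminus ` K = {0}"

definition dual_cone :: "'a::real_normed_vector set \<Rightarrow> ('a \<Rightarrow>\<^sub>L real) set" where
  "dual_cone K = {f. \<forall>y\<in>K. 0 \<le> blinfun_apply f y}"

text \<open>Surjectivity of the canonical embedding into the bidual. The argument only carries the
  type, as in \<open>CARD('a)\<close>.\<close>

definition reflexive_space :: "'a::real_normed_vector itself \<Rightarrow> bool" where
  "reflexive_space _ \<longleftrightarrow>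
     (\<forall>\<phi> :: ('a \<Rightarrow>\<^sub>L real) \<Rightarrow>\<^sub>L real. \<exists>y::'a. \<forall>f. blinfun_apply \<phi> f = blinfun_apply f y)"

text \<open>The members of a neighborhood base need not be open. The sets \<open>V + K\<close> and \<open>V - K\<close> are
  Minkowski sums, written out because \<open>-\<close> on sets is set difference.\<close>

definition normal_cone :: "'a::real_normed_vector set \<Rightarrow> bool" where
  "normal_cone K \<longleftrightarrow>
     (\<exists>\<V> :: 'a set set.
        (\<forall>V\<in>\<V>. 0 \<in> interior V) \<and>
        (\<forall>U. 0 \<in> interior U \<longrightarrow> (\<exists>V\<in>\<V>. V \<subseteq> U)) \<and>
        (\<forall>V\<in>\<V>. V = {v + k | v k. v \<in> V \<and> k \<in> K} \<inter> {v - k | v k. v \<in> V \<and> k \<in> K}))"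

definition Psi_GW :: "'a::real_normed_vector set \<Rightarrow> 'a \<Rightarrow> 'a \<Rightarrow> real" where
  "Psi_GW K r y = (LEAST t. t *\<^sub>R r \<in> {y + k | k. k \<in> K})"

definition Omega_GW :: "'a::real_normed_vector set \<Rightarrow> ('a \<Rightarrow> real) set" where
  "Omega_GW K = {Psi_GW K r | r. r \<in> interior K}"

definition equivalent_norm :: "('a::real_normed_vector \<Rightarrow> real) \<Rightarrow> bool" where
  "equivalent_norm N \<longleftrightarrow>
     (\<forall>x. N x = 0 \<longleftrightarrow> x = 0) \<and>
     (\<forall>c x. N (c *\<^sub>R x) = \<bar>c\<bar> * N x) \<and>
     (\<forall>x y. N (x + y) \<le> N x + N y) \<and>
     (\<exists>a>0. \<exists>b>0. \<forall>x. a * norm x \<le> N x \<and> N x \<le> b * norm x)"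

text \<open>Used only for nonempty \<open>A\<close>; \<open>infdist\<close> is tied to the norm of the type.\<close>

definition norm_dist :: "('a::real_vector \<Rightarrow> real) \<Rightarrow> 'a \<Rightarrow> 'a set \<Rightarrow> real" where
  "norm_dist N y A = (INF a\<in>A. N (y - a))"

definition Psi_HU :: "'a::real_normed_vector set \<Rightarrow> ('a \<Rightarrow> real) \<Rightarrow> 'a \<Rightarrow> real" where
  "Psi_HU K N y = norm_dist N y (uminus ` K) - norm_dist N y (UNIV - uminus ` K)"

definition Omega_HU :: "'a::real_normed_vector set \<Rightarrow> ('a \<Rightarrow> real) set" where
  "Omega_HU K = {Psi_HU K N | N. equivalent_norm N}"

text \<open>For real-valued operators, \<open>strong_operator_topology\<close> is the topology of pointwise
  convergence on the dual, i.e. the weak-star topology.\<close>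

abbreviation weak_star_topology :: "('a::real_normed_vector \<Rightarrow>\<^sub>L real) topology" where
  "weak_star_topology \<equiv> strong_operator_topology"

definition generator :: "'a::real_normed_vector set \<Rightarrow> ('a \<Rightarrow>\<^sub>L real) set \<Rightarrow> bool" where
  "generator K G \<longleftrightarrow>
     convex G \<and>
     0 \<notin> weak_star_topology closure_of G \<and>
     dual_cone K = {t *\<^sub>R f | t f. 0 \<le> t \<and> f \<in> G}"

definition Psi_DS :: "('a::real_normed_vector \<Rightarrow>\<^sub>L real) set \<Rightarrow> 'a \<Rightarrow> real" where
  "Psi_DS G y = (GREATEST t. \<exists>f\<in>G. t = blinfun_apply f y)"

definition Omega_DS :: "'a::real_normed_vector set \<Rightarrow> ('a \<Rightarrow> real) set" where
  "Omega_DS K = {Psi_DS G | G. generator K G \<and> compactin weak_star_topology G}"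

text \<open>The standing assumptions on the pair of the Banach space \<open>'a\<close> and the cone \<open>K\<close>.\<close>

definition admissible :: "'a::banach set \<Rightarrow> bool" where
  "admissible K \<longleftrightarrow>
     (\<exists>y::'a. y \<noteq> 0) \<and>
     closed K \<and> convex K \<and> cone K \<and> pointed K \<and> interior K \<noteq> {} \<and>
     (reflexive_space TYPE('a) \<or> normal_cone K)"

end

theory Submission
  imports Defs
begin

text \<open>For \<open>\<Omega>\<^sub>G\<^sub>W \<subseteq> \<Omega>\<^sub>H\<^sub>U\<close>, any equivalent norm \<open>N\<close> with \<open>N r = 1\<close> and \<open>\<Psi>\<^sub>r \<le> N\<close> has \<open>\<Psi>\<^sub>r\<close> as its oriented
  distance. For \<open>\<Omega>\<^sub>H\<^sub>U \<subseteq> \<Omega>\<^sub>D\<^sub>S\<close>, the oriented distance \<open>\<Psi>\<close> is sublinear, so by Hahn-Banach it is the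
  maximum over \<open>G = {f. f \<le> \<Psi>}\<close>. This \<open>G\<close> is weak-star compact by Tychonoff, is bounded away from \<open>0\<close>
  at an interior point of \<open>K\<close>, and contains every functional of \<open>K\<^sup>*\<close> of dual norm one.

  Strictness is seen in the quadrant of the plane: the oriented distance of the \<open>\<ell>\<^sub>1\<close> norm is
  \<open>y\<^sub>1 + y\<^sub>2\<close> on the quadrant, while each \<open>\<Psi>\<^sub>r\<close> is a maximum of multiples of the coordinates; and the
  support function of a triangle pointing towards the origin is no oriented distance.\<close>

subsection \<open>Sublinear functionals\<close>

text \<open>Homogeneity is only demanded as an inequality, the form that passes to infima;
  \<open>sublinear_scaleR\<close> recovers equality by applying it to the inverse factor.\<close>

definition sublinear :: "('a::real_vector \<Rightarrow> real) \<Rightarrow> bool" where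
  "sublinear p \<longleftrightarrow> (\<forall>x y. p (x + y) \<le> p x + p y) \<and> (\<forall>c x. 0 \<le> c \<longrightarrow> p (c *\<^sub>R x) \<le> c * p x)"

lemma sublinearD:
  assumes "sublinear p"
  shows sublinear_add: "p (x + y) \<le> p x + p y"
    and sublinear_zero: "p 0 = 0"
    and sublinear_scaleR: "0 \<le> c \<Longrightarrow> p (c *\<^sub>R x) = c * p x"
    and sublinear_minus: "- p (- x) \<le> p x"
proof -
  have le: "0 \<le> c \<Longrightarrow> p (c *\<^sub>R x) \<le> c * p x" for c x
    using assms by (simp add: sublinear_def)
  have add: "p (x + y) \<le> p x + p y" for x y
    using assms by (simp add: sublinear_def)
  then show "p (x + y) \<le> p x + p y" .
  show z: "p 0 = 0"
    using le[of 0 0] add[of 0 0] by simp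
  show "- p (- x) \<le> p x"
    using add[of x "- x"] z by simp
  show "p (c *\<^sub>R x) = c * p x" if "0 \<le> c"
  proof (cases "c = 0")
    case True
    then show ?thesis by (simp add: z)
  next
    case False
    with that have "c > 0" by simp
    have "p x \<le> inverse c * p (c *\<^sub>R x)"
      using le[of "inverse c" "c *\<^sub>R x"] \<open>c > 0\<close> by simp
    then have "c * p x \<le> p (c *\<^sub>R x)"
      using \<open>c > 0\<close> by (simp add: field_simps)
    with le[OF that, of x] show ?thesis by simp
  qed
qed

section \<open>Minimal sublinear functionals and the Hahn-Banach theorem\<close>

text \<open>The largest sublinear functional below \<open>p\<close> that is at most \<open>- p z\<close> at \<open>- z\<close>. A minimal sublinear
  functional coincides with its own descent in every direction, which forces additivity.\<close>

definition descent :: "('a::real_vector \<Rightarrow> real) \<Rightarrow> 'a \<Rightarrow> 'a \<Rightarrow> real" where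
  "descent p z x = (INF t\<in>{0..}. p (x + t *\<^sub>R z) - t * p z)"

text \<open>The infimum is finite: \<open>t * p z = p (t *\<^sub>R z) \<le> p (x + t *\<^sub>R z) +
  p (- x)\<close>, so \<open>- p (- x)\<close> is a lower bound.\<close>

lemma descent_le:
  assumes "sublinear p" "0 \<le> t"
  shows "descent p z x \<le> p (x + t *\<^sub>R z) - t * p z"
proof -
  have "- p (- x) \<le> p (x + t *\<^sub>R z) - t * p z" if "0 \<le> t" for t
    using sublinear_add[OF assms(1), of "x + t *\<^sub>R z" "- x"]
      sublinear_scaleR[OF assms(1) that, of z] by simp
  then have "bdd_below ((\<lambda>t. p (x + t *\<^sub>R z) - t * p z) ` {0..})"
    by (intro bdd_belowI[of _ "- p (- x)"]) auto
  then show ?thesis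
    unfolding descent_def using assms(2) by (intro cINF_lower) auto
qed

text \<open>A parameter \<open>s\<close> for \<open>x\<close> and a parameter \<open>t\<close> for
  \<open>y\<close> combine to \<open>s + t\<close> for \<open>x + y\<close>, and scaling by
  \<open>c\<close> turns \<open>t\<close> into \<open>c * t\<close>. The two infima are taken one
  after the other.\<close>

lemma sublinear_descent:
  assumes p: "sublinear p"
  shows "sublinear (descent p z)"
  unfolding sublinear_def
proof (intro conjI allI impI)
  fix x y
  have *: "descent p z (x + y) - (p (y + t *\<^sub>R z) - t * p z) \<le> p (x + s *\<^sub>R z) - s * p z"
    if "0 \<le> s" "0 \<le> t" for s t
    using descent_le[OF p, of "s + t" z "x + y"] that
      sublinear_add[OF p, of "x + s *\<^sub>R z" "y + t *\<^sub>R z"]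
    by (simp add: algebra_simps)
  have "descent p z (x + y) - (p (y + t *\<^sub>R z) - t * p z) \<le> descent p z x" if "0 \<le> t" for t
    unfolding descent_def[of p z x] using * that by (intro cINF_greatest) auto
  then have "descent p z (x + y) - descent p z x \<le> descent p z y"
    unfolding descent_def[of p z y] by (intro cINF_greatest) (auto simp: algebra_simps)
  then show "descent p z (x + y) \<le> descent p z x + descent p z y" by simp
next
  fix c :: real and x assume "0 \<le> c"
  show "descent p z (c *\<^sub>R x) \<le> c * descent p z x"
  proof (cases "c = 0")
    case True
    then show ?thesis
      using descent_le[OF p, of 0 z 0] sublinear_zero[OF p] by simp
  next
    case False
    with \<open>0 \<le> c\<close> have "c > 0" by simp
    have "descent p z (c *\<^sub>R x) / c \<le> p (x + t *\<^sub>R z) - t * p z" if "0 \<le> t" for t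
    proof -
      have "descent p z (c *\<^sub>R x) \<le> p (c *\<^sub>R (x + t *\<^sub>R z)) - (c * t) * p z"
        using descent_le[OF p, of "c * t" z "c *\<^sub>R x"] that \<open>c > 0\<close> by (simp add: scaleR_add_right)
      also have "\<dots> = c * (p (x + t *\<^sub>R z) - t * p z)"
        using sublinear_scaleR[OF p, of c "x + t *\<^sub>R z"] \<open>c > 0\<close> by (simp add: algebra_simps)
      finally show ?thesis using \<open>c > 0\<close> by (simp add: field_simps)
    qed
    then have "descent p z (c *\<^sub>R x) / c \<le> descent p z x"
      unfolding descent_def[of p z x] by (intro cINF_greatest) auto
    then show ?thesis using \<open>c > 0\<close> by (simp add: field_simps)
  qed
qed

text \<open>The parameter \<open>t = 0\<close> shows that the descent lies below \<open>p\<close>,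
  so minimality makes them equal; then \<open>t = 1\<close> gives superadditivity.\<close>

lemma minimal_sublinear_imp_linear:
  assumes p: "sublinear p"
    and min: "\<And>p'. sublinear p' \<Longrightarrow> (\<And>x. p' x \<le> p x) \<Longrightarrow> p' = p"
  shows "linear p"
proof -
  have "descent p z = p" for z
    using descent_le[OF p, of 0] by (intro min sublinear_descent[OF p]) simp
  then have ge: "p x + p z \<le> p (x + z)" for x z
    using descent_le[OF p, of 1 z x] by simp
  have add: "p (x + y) = p x + p y" for x y
    using ge[of x y] sublinear_add[OF p, of x y] by simp
  have neg: "p (- x) = - p x" for x
    using add[of x "- x"] sublinear_zero[OF p] by simp
  have "p (c *\<^sub>R x) = c * p x" for c x
  proof (cases "0 \<le> c")
    case True
    then show ?thesis by (rule sublinear_scaleR[OF p])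
  next
    case False
    then show ?thesis
      using sublinear_scaleR[OF p, of "- c" x] neg[of "c *\<^sub>R x"] by simp
  qed
  with add show ?thesis by (intro linearI) auto
qed

text \<open>Zorn's lemma provides a minimal sublinear functional below \<open>q\<close>, which is
  linear. The bound of a nonempty chain is its pointwise infimum.\<close>

lemma exists_linear_below:
  assumes q: "sublinear q"
  obtains f where "linear f" "\<And>x. f x \<le> q x"
proof -
  define A where "A = {p. sublinear p \<and> (\<forall>x. p x \<le> q x)}"
  \<comment> \<open>The order is reversed, so that a maximal element for \<open>P\<close> is a
    minimal functional.\<close>
  define P where "P = (\<lambda>p p' :: 'a \<Rightarrow> real. \<forall>x. p' x \<le> p x)"
  have "\<exists>m\<in>A. \<forall>a\<in>A. P m a \<longrightarrow> a = m"
  proof (rule predicate_Zorn)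
    show "partial_order_on A (relation_of P A)"
      by (rule partial_order_on_relation_ofI) (auto simp: P_def fun_eq_iff intro: order_trans antisym)
  next
    fix C assume C: "C \<in> Chains (relation_of P A)"
    then have CA: "C \<subseteq> A" and total: "\<And>a b. a \<in> C \<Longrightarrow> b \<in> C \<Longrightarrow> P a b \<or> P b a"
      by (auto simp: Chains_def relation_of_def)
    show "\<exists>u\<in>A. \<forall>a\<in>C. P a u"
    proof (cases "C = {}")
      case True
      then show ?thesis using q by (auto simp: A_def)
    next
      case False
      define u where "u x = (INF p\<in>C. p x)" for x
      have lb: "- q (- x) \<le> p x" if "p \<in> C" for p x
      proof -
        have "sublinear p" "p (- x) \<le> q (- x)" using that CA by (auto simp: A_def)
        then show ?thesis using sublinear_minus[of p x] by linarith
      qed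
      have u_le: "u x \<le> p x" if "p \<in> C" for p x
        unfolding u_def using lb that by (intro cINF_lower bdd_belowI[of _ "- q (- x)"]) auto
      have u_ge: "m \<le> u x" if "\<And>p. p \<in> C \<Longrightarrow> m \<le> p x" for m x
        unfolding u_def using that False by (intro cINF_greatest) auto
      have "sublinear u"
        unfolding sublinear_def
      proof (intro conjI allI impI)
        fix x y
        \<comment> \<open>Of two members of the chain, the smaller one supplies the
          subadditivity.\<close>
        have *: "u (x + y) \<le> p x + p' y" if "p \<in> C" "p' \<in> C" for p p'
        proof -
          have sub: "sublinear p" "sublinear p'" using that CA by (auto simp: A_def)
          from total[OF that] show ?thesis
          proof
            assume "P p p'"
            then have "p' x \<le> p x" by (simp add: P_def)
            then show ?thesis
              using u_le[OF that(2), of "x + y"] sublinear_add[OF sub(2), of x y] by simp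
          next
            assume "P p' p"
            then have "p y \<le> p' y" by (simp add: P_def)
            then show ?thesis
              using u_le[OF that(1), of "x + y"] sublinear_add[OF sub(1), of x y] by simp
          qed
        qed
        have "u (x + y) - p' y \<le> u x" if "p' \<in> C" for p'
          using * that by (intro u_ge) (simp add: algebra_simps)
        then have "u (x + y) - u x \<le> u y"
          by (intro u_ge) (simp add: algebra_simps)
        then show "u (x + y) \<le> u x + u y" by simp
      next
        fix c :: real and x assume "0 \<le> c"
        have *: "u (c *\<^sub>R x) \<le> c * p x" if "p \<in> C" for p
          using u_le[OF that, of "c *\<^sub>R x"] that CA sublinear_scaleR[of p c x] \<open>0 \<le> c\<close>
          by (auto simp: A_def)
        show "u (c *\<^sub>R x) \<le> c * u x"
        proof (cases "c = 0")
          case True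
          then show ?thesis using * False by auto
        next
          case False
          with \<open>0 \<le> c\<close> have "c > 0" by simp
          then have "u (c *\<^sub>R x) / c \<le> u x"
            using * by (intro u_ge) (simp add: field_simps)
          then show ?thesis using \<open>c > 0\<close> by (simp add: field_simps)
        qed
      qed
      moreover have "u x \<le> q x" for x
      proof -
        obtain p where "p \<in> C" using \<open>C \<noteq> {}\<close> by auto
        then have "p x \<le> q x" using CA by (auto simp: A_def)
        with u_le[OF \<open>p \<in> C\<close>, of x] show ?thesis by simp
      qed
      ultimately show ?thesis using u_le by (auto simp: A_def P_def)
    qed
  qed
  then obtain m where m: "m \<in> A" and min: "\<And>a. a \<in> A \<Longrightarrow> P m a \<Longrightarrow> a = m" by blast
  have "linear m"
  proof (rule minimal_sublinear_imp_linear)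
    show "sublinear m" using m by (simp add: A_def)
    fix p' assume "sublinear p'" "\<And>x. p' x \<le> m x"
    with m show "p' = m" by (intro min) (auto simp: A_def P_def intro: order_trans)
  qed
  with m that show ?thesis by (auto simp: A_def)
qed

text \<open>A linear functional below the descent of \<open>q\<close> along \<open>z\<close> lies
  below \<open>q\<close> (parameter 0) and is at most \<open>- q z\<close> at \<open>- z\<close>
  (parameter 1), which forces equality at \<open>z\<close>.\<close>

theorem hahn_banach_sublinear:
  assumes q: "sublinear q"
  obtains f where "linear f" "\<And>x. f x \<le> q x" "f z = q z"
proof -
  obtain f where f: "linear f" "\<And>x. f x \<le> descent q z x"
    using exists_linear_below[OF sublinear_descent[OF q]] by blast
  have le: "f x \<le> q x" for x
    using f(2)[of x] descent_le[OF q, of 0 z x] by simp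
  have "f (- z) \<le> - q z"
    using f(2)[of "- z"] descent_le[OF q, of 1 z "- z"] sublinear_zero[OF q] by simp
  with le[of z] have "f z = q z" by (simp add: linear_neg[OF f(1)])
  with f(1) le that show ?thesis by blast
qed

section \<open>Bounded functionals and the weak-star topology\<close>

lemma linear_le_imp_bounded_linear:
  fixes f :: "'a::real_normed_vector \<Rightarrow> real"
  assumes "linear f" "\<And>x. f x \<le> C * norm x"
  shows "bounded_linear f"
proof -
  have "\<bar>f x\<bar> \<le> norm x * C" for x
    using assms(2)[of x] assms(2)[of "- x"] linear_neg[OF assms(1), of x]
    by (simp add: abs_le_iff mult.commute)
  then show ?thesis
    using assms(1) by (intro bounded_linear_intro) (auto simp: linear_add linear_scale)
qed

text \<open>The Banach-Alaoglu argument: the linear functions below \<open>q\<close> form a closed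
  subset of a product of compact intervals, and \<open>Blinfun\<close> carries this set continuously
  onto the set of functionals, both topologies being those of pointwise convergence.\<close>

theorem compactin_weak_star_dominated:
  fixes q :: "'a::real_normed_vector \<Rightarrow> real"
  assumes q: "\<And>x. q x \<le> C * norm x"
  shows "compactin weak_star_topology {f. \<forall>x. blinfun_apply f x \<le> q x}"
proof -
  define L where "L = {g :: 'a \<Rightarrow> real. linear g \<and> (\<forall>x. g x \<le> q x)}"
  have bl: "bounded_linear g" if "g \<in> L" for g
    using that q by (intro linear_le_imp_bounded_linear[of g C]) (auto simp: L_def intro: order_trans)
  \<comment> \<open>Linearity and domination become conditions on finitely many coordinates at a
    time, each of them closed.\<close>
  have L_eq: "L = (\<Inter>x y. {g. g (x + y) = g x + g y}) \<inter> (\<Inter>c x. {g. g (c *\<^sub>R x) = c * g x}) \<inter>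
      (\<Inter>x. {g. g x \<le> q x})"
    by (auto simp: L_def linear_add linear_scale intro: linearI)
  have "closed L"
    unfolding L_eq
    by (intro closed_Int closed_INT ballI closed_Collect_eq closed_Collect_le continuous_intros)
       auto
  moreover have "L \<subseteq> PiE UNIV (\<lambda>x. {- q (- x)..q x})"
  proof
    fix g assume "g \<in> L"
    then have "- q (- x) \<le> g x \<and> g x \<le> q x" for x
      using linear_neg[of g x] by (auto simp: L_def minus_le_iff dest: spec[of _ "- x"])
    then show "g \<in> PiE UNIV (\<lambda>x. {- q (- x)..q x})" by (auto simp: PiE_def)
  qed
  moreover have "compactin euclidean (PiE UNIV (\<lambda>x::'a. {- q (- x)..q x}))"
    using compactin_PiE[of "\<lambda>_. euclidean" UNIV "\<lambda>x. {- q (- x)..q x}"]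
    unfolding euclidean_product_topology by simp
  ultimately have "compactin euclidean L"
    using closed_compactin by (metis closed_closedin)
  then have "compactin (subtopology euclidean L) L" by simp
  moreover have "continuous_map (subtopology euclidean L) weak_star_topology Blinfun"
    unfolding continuous_on_strong_operator_topo_iff_coordinatewise
  proof
    fix x :: 'a
    have "continuous_map (subtopology euclidean L) euclidean (\<lambda>g. g x)"
      using continuous_on_subset[OF continuous_on_product_coordinates[of x] subset_UNIV] by simp
    then show "continuous_map (subtopology euclidean L) euclidean (\<lambda>g. blinfun_apply (Blinfun g) x)"
      by (rule continuous_map_eq) (simp add: bounded_linear_Blinfun_apply bl)
  qed
  ultimately have "compactin weak_star_topology (Blinfun ` L)"
    by (rule image_compactin)
  moreover have "Blinfun ` L = {f. \<forall>x. blinfun_apply f x \<le> q x}"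
  proof (intro equalityI subsetI)
    fix f assume "f \<in> Blinfun ` L"
    then show "f \<in> {f. \<forall>x. blinfun_apply f x \<le> q x}"
      by (auto simp: bounded_linear_Blinfun_apply bl) (simp add: L_def)
  next
    fix f assume "f \<in> {f. \<forall>x. blinfun_apply f x \<le> q x}"
    then have "blinfun_apply f \<in> L" by (simp add: L_def bounded_linear.linear[OF blinfun.bounded_linear_right])
    then show "f \<in> Blinfun ` L" by (intro image_eqI[of _ _ "blinfun_apply f"]) (simp_all add: blinfun_apply_inverse)
  qed
  ultimately show ?thesis by simp
qed

text \<open>Evaluation at \<open>r\<close> is weak-star continuous, so an open half-space separates
  0 from \<open>G\<close>.\<close>

lemma zero_notin_weak_star_closure:
  assumes "0 < \<delta>" and G: "\<And>f. f \<in> G \<Longrightarrow> \<delta> \<le> blinfun_apply f r"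
  shows "0 \<notin> weak_star_topology closure_of G"
proof
  \<comment> \<open>The one-element index set \<open>{()}\<close> puts the half-space into the form
    of a basic open set.\<close>
  define U where "U = {f. \<forall>i\<in>{()}. blinfun_apply f r \<in> {..<\<delta>}}"
  have "openin weak_star_topology U"
    unfolding U_def by (rule strong_operator_topology_basis) auto
  moreover have "0 \<in> U" using assms(1) by (simp add: U_def)
  moreover assume "0 \<in> weak_star_topology closure_of G"
  ultimately have "\<exists>f. f \<in> G \<and> f \<in> U" by (simp add: in_closure_of)
  then show False using G by (force simp: U_def)
qed

subsection \<open>Oriented distances\<close>

lemma equivalent_normD:
  assumes "equivalent_norm N"
  shows equivalent_norm_zero: "N 0 = 0"
    and equivalent_norm_eq_zero: "N x = 0 \<longleftrightarrow> x = 0"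
    and equivalent_norm_scaleR: "N (c *\<^sub>R x) = \<bar>c\<bar> * N x"
    and equivalent_norm_minus: "N (- x) = N x"
    and equivalent_norm_triangle: "N (x + y) \<le> N x + N y"
    and equivalent_norm_nonneg: "0 \<le> N x"
    and equivalent_norm_le_zero: "N x \<le> 0 \<longleftrightarrow> x = 0"
proof -
  show eq0: "N x = 0 \<longleftrightarrow> x = 0" for x
    using assms by (simp add: equivalent_norm_def)
  then show "N 0 = 0" by simp
  show sc: "N (c *\<^sub>R x) = \<bar>c\<bar> * N x" for c x
    using assms by (simp add: equivalent_norm_def)
  from sc[of "-1"] show "N (- x) = N x" by simp
  show "N (x + y) \<le> N x + N y"
    using assms by (simp add: equivalent_norm_def)
  obtain a where "a > 0" "a * norm x \<le> N x"
    using assms by (auto simp: equivalent_norm_def)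
  then show "0 \<le> N x"
    by (meson order.trans mult_nonneg_nonneg less_imp_le norm_ge_zero)
  with eq0[of x] show "N x \<le> 0 \<longleftrightarrow> x = 0" by linarith
qed

text \<open>The values \<open>u - v\<close> for which \<open>y\<close> is within distance \<open>u\<close> of a point whose \<open>v\<close>-ball lies in \<open>- K\<close>.
  Their infimum is \<open>Psi_HU K N y\<close>; since the sets add up as Minkowski sums, sublinearity needs no
  distinction of whether the arguments lie inside or outside \<open>- K\<close>.\<close>

definition gap_set :: "'a::real_vector set \<Rightarrow> ('a \<Rightarrow> real) \<Rightarrow> 'a \<Rightarrow> real set" where
  "gap_set K N y =
     {u - v | u v. 0 \<le> u \<and> 0 \<le> v \<and> (\<exists>z. N z \<le> u \<and> (\<forall>w. N w \<le> v \<longrightarrow> z - y + w \<in> K))}"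

section \<open>The oriented distance as an infimum over the gap set\<close>

text \<open>The assumption \<open>proper\<close> makes the complement of \<open>- K\<close>
  nonempty, so that the distance to it is the infimum of a nonempty set.\<close>

locale proper_cone =
  fixes K :: "'a::real_normed_vector set"
  assumes closed: "closed K"
    and add: "x \<in> K \<Longrightarrow> y \<in> K \<Longrightarrow> x + y \<in> K"
    and scaleR: "x \<in> K \<Longrightarrow> 0 \<le> c \<Longrightarrow> c *\<^sub>R x \<in> K"
    and pointed: "x \<in> K \<Longrightarrow> - x \<in> K \<Longrightarrow> x = 0"
    and interior: "interior K \<noteq> {}"
    and proper: "K \<noteq> UNIV"
begin

lemma zero: "0 \<in> K"
  using interior interior_subset scaleR[of _ 0] by fastforce

lemma norm_dist_K: "norm_dist N y (uminus ` K) = (INF k\<in>K. N (y + k))"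
  by (simp add: norm_dist_def image_image)

lemma norm_dist_compl: "norm_dist N y (UNIV - uminus ` K) = (INF a\<in>{a. - a \<notin> K}. N (y - a))"
proof -
  have "UNIV - uminus ` K = {a. - a \<notin> K}" by (force simp: image_iff)
  then show ?thesis by (simp add: norm_dist_def)
qed

lemma compl_nonempty: "{a. - a \<notin> K} \<noteq> {}"
  using proper by (metis (mono_tags) UNIV_eq_I empty_Collect_eq minus_minus)

context
  fixes N :: "'a \<Rightarrow> real" assumes N: "equivalent_norm N"
begin

lemma bdd_below_norm: "bdd_below ((\<lambda>x. N (f x)) ` A)"
  using equivalent_norm_nonneg[OF N] by (intro bdd_belowI[of _ 0]) auto

lemma norm_dist_K_zero: "- y \<in> K \<Longrightarrow> norm_dist N y (uminus ` K) = 0"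
  unfolding norm_dist_K
  using cINF_lower[OF bdd_below_norm[of "\<lambda>k. y + k"], of "- y" K]
    cINF_greatest[of K 0 "\<lambda>k. N (y + k)"] equivalent_norm_nonneg[OF N] equivalent_norm_zero[OF N]
  by force

lemma norm_dist_compl_zero: "- y \<notin> K \<Longrightarrow> norm_dist N y (UNIV - uminus ` K) = 0"
  unfolding norm_dist_compl
  using cINF_lower[OF bdd_below_norm[of "\<lambda>a. y - a"], of y "{a. - a \<notin> K}"]
    cINF_greatest[of "{a. - a \<notin> K}" 0 "\<lambda>a. N (y - a)"] equivalent_norm_nonneg[OF N] equivalent_norm_zero[OF N]
  by force

text \<open>On \<open>- K\<close> the first distance vanishes. In this form, values of an oriented
  distance become lower bounds on \<open>N\<close>, as the triangle example requires.\<close>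

lemma Psi_HU_le_minus_iff:
  assumes "- y \<in> K"
  shows "Psi_HU K N y \<le> - c \<longleftrightarrow> (\<forall>a. - a \<notin> K \<longrightarrow> c \<le> N (y - a))"
proof -
  have "Psi_HU K N y \<le> - c \<longleftrightarrow> c \<le> (INF a\<in>{a. - a \<notin> K}. N (y - a))"
    using norm_dist_K_zero[OF assms] by (simp add: Psi_HU_def norm_dist_compl)
  also have "\<dots> \<longleftrightarrow> (\<forall>a. - a \<notin> K \<longrightarrow> c \<le> N (y - a))"
    using le_cINF_iff[OF compl_nonempty bdd_below_norm[of "\<lambda>a. y - a"], of c] by simp
  finally show ?thesis .
qed

text \<open>The \<open>v\<close>-ball around \<open>y - z\<close> lies in \<open>- K\<close>. If
  \<open>y\<close> is in \<open>- K\<close>, no point closer to \<open>y\<close> than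
  \<open>v - u\<close> can leave \<open>- K\<close>. Otherwise, the segment from \<open>y\<close> to
  \<open>y - z\<close> enters that ball after a length of at most \<open>u - v\<close>.\<close>

lemma Psi_HU_le_gap:
  assumes "s \<in> gap_set K N y"
  shows "Psi_HU K N y \<le> s"
proof -
  obtain u v z where s: "s = u - v" and uv: "0 \<le> u" "0 \<le> v" and z: "N z \<le> u"
    and ball: "\<And>w. N w \<le> v \<Longrightarrow> z - y + w \<in> K"
    using assms by (auto simp: gap_set_def)
  show ?thesis
  proof (cases "- y \<in> K")
    case True
    have "v - u \<le> N (y - a)" if "- a \<notin> K" for a
    proof (rule ccontr)
      assume "\<not> ?thesis"
      then have "N ((y - a) + (- z)) \<le> v"
        using equivalent_norm_triangle[OF N, of "y - a" "- z"] equivalent_norm_minus[OF N, of z] z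
        by linarith
      from ball[OF this] that show False by (simp add: algebra_simps)
    qed
    then have "v - u \<le> (INF a\<in>{a. - a \<notin> K}. N (y - a))"
      by (intro cINF_greatest[OF compl_nonempty]) auto
    then show ?thesis
      using norm_dist_K_zero[OF True] by (simp add: Psi_HU_def norm_dist_compl s)
  next
    case False
    have "u > v"
    proof (rule ccontr)
      assume "\<not> u > v"
      then have "N (- z) \<le> v" using z equivalent_norm_minus[OF N, of z] by linarith
      from ball[OF this] False show False by simp
    qed
    \<comment> \<open>The last fraction \<open>v / u\<close> of the segment lies inside the ball, so
      only the fraction \<open>1 - v / u\<close> has to be travelled.\<close>
    have "N ((v / u) *\<^sub>R z) = (v / u) * N z"
      using uv by (simp add: equivalent_norm_scaleR[OF N])
    also have "\<dots> \<le> (v / u) * u" using uv z by (intro mult_left_mono) auto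
    also have "\<dots> = v" using \<open>u > v\<close> uv by simp
    finally have "z - y + - ((v / u) *\<^sub>R z) \<in> K"
      using ball[of "- ((v / u) *\<^sub>R z)"] by (simp add: equivalent_norm_minus[OF N])
    then have "norm_dist N y (uminus ` K) \<le> N (y + (z - y + - ((v / u) *\<^sub>R z)))"
      unfolding norm_dist_K by (intro cINF_lower bdd_below_norm)
    also have "\<dots> = N ((1 - v / u) *\<^sub>R z)" by (simp add: algebra_simps)
    also have "\<dots> = (1 - v / u) * N z"
      using \<open>u > v\<close> uv by (simp add: equivalent_norm_scaleR[OF N] field_simps)
    also have "\<dots> \<le> (1 - v / u) * u"
      using \<open>u > v\<close> uv z by (intro mult_left_mono) (auto simp: field_simps)
    also have "\<dots> = u - v" using \<open>u > v\<close> uv by (simp add: field_simps)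
    finally show ?thesis
      using norm_dist_compl_zero[OF False] by (simp add: Psi_HU_def s)
  qed
qed

text \<open>The converse estimate. The distances need not be attained, so the infimum is approached:
  inside \<open>- K\<close> by balls around \<open>y\<close> itself (\<open>u = 0\<close>), outside
  by nearly closest points (\<open>v = 0\<close>).\<close>

lemma ex_gap_less:
  assumes "Psi_HU K N y < s'"
  obtains s where "s \<in> gap_set K N y" "s < s'"
proof (cases "- y \<in> K")
  case True
  define d where "d = (INF a\<in>{a. - a \<notin> K}. N (y - a))"
  have d: "- d < s'"
    using assms norm_dist_K_zero[OF True] by (simp add: Psi_HU_def norm_dist_compl d_def)
  \<comment> \<open>The midpoint between \<open>- s'\<close> and \<open>d\<close>, clamped at 0. It
    is either below \<open>d\<close>, so that the ball stays inside, or 0, so that the ball is a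
    point.\<close>
  define v where "v = max 0 ((d - s') / 2)"
  have "- v \<in> gap_set K N y"
  proof -
    have "- y + w \<in> K" if w: "N w \<le> v" for w
    proof (cases "d \<le> v")
      case True
      with d have "v = 0" by (auto simp: v_def max_def split: if_splits)
      with w have "w = 0"
        using equivalent_norm_le_zero[OF N, of w] by simp
      with \<open>- y \<in> K\<close> show ?thesis by simp
    next
      case False
      show ?thesis
      proof (rule ccontr)
        assume "- y + w \<notin> K"
        then have "d \<le> N (y - (y - w))"
          unfolding d_def by (intro cINF_lower bdd_below_norm) auto
        with w False show False by simp
      qed
    qed
    then show ?thesis
      unfolding gap_set_def mem_Collect_eq
      by (intro exI[of _ 0] exI[of _ v] conjI) (auto simp: v_def equivalent_norm_zero[OF N])
  qed
  moreover have "- v < s' \<or> (v = 0 \<and> s' \<le> 0 \<and> d \<le> s')"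
    using d by (auto simp: v_def max_def field_simps)
  moreover have "0 \<le> d"
    unfolding d_def by (intro cINF_greatest compl_nonempty equivalent_norm_nonneg[OF N])
  ultimately show ?thesis using d that by force
next
  case False
  then have "(INF k\<in>K. N (y + k)) < s'"
    using assms norm_dist_compl_zero[OF False] by (simp add: Psi_HU_def norm_dist_K)
  moreover have "K \<noteq> {}" using zero by auto
  ultimately obtain k where k: "k \<in> K" "N (y + k) < s'"
    using cINF_less_iff[OF _ bdd_below_norm[of "\<lambda>k. y + k" K], of s'] by auto
  have "(y + k) - y + w \<in> K" if "N w \<le> 0" for w
    using that k(1) by (simp add: equivalent_norm_le_zero[OF N])
  then have "N (y + k) - 0 \<in> gap_set K N y"
    unfolding gap_set_def mem_Collect_eq
    by (intro exI[of _ "N (y + k)"] exI[of _ 0] exI[of _ "y + k"] conjI)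
       (auto simp: equivalent_norm_nonneg[OF N])
  with k(2) that show ?thesis by simp
qed

lemma le_Psi_HU:
  assumes "\<And>s. s \<in> gap_set K N y \<Longrightarrow> t \<le> s"
  shows "t \<le> Psi_HU K N y"
proof (rule ccontr)
  assume "\<not> ?thesis"
  then have "Psi_HU K N y < t" by simp
  then obtain s where "s \<in> gap_set K N y" "s < t" by (rule ex_gap_less)
  with assms[of s] show False by simp
qed

lemma Psi_HU_eqI:
  assumes "t \<in> gap_set K N y" "\<And>s. s \<in> gap_set K N y \<Longrightarrow> t \<le> s"
  shows "Psi_HU K N y = t"
  by (intro antisym Psi_HU_le_gap le_Psi_HU assms)

text \<open>Centres and radii add up: a vector \<open>w\<close> in the ball of radius
  \<open>v + v'\<close> is split in the proportion of \<open>v\<close> to \<open>v'\<close>. Both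
  radii being 0 is treated apart, to avoid dividing by 0.\<close>

lemma gap_set_add:
  assumes "s \<in> gap_set K N x" "t \<in> gap_set K N y"
  shows "s + t \<in> gap_set K N (x + y)"
proof -
  obtain u v z where s: "s = u - v" "0 \<le> u" "0 \<le> v" "N z \<le> u"
    and ball: "\<And>w. N w \<le> v \<Longrightarrow> z - x + w \<in> K"
    using assms(1) by (auto simp: gap_set_def)
  obtain u' v' z' where t: "t = u' - v'" "0 \<le> u'" "0 \<le> v'" "N z' \<le> u'"
    and ball': "\<And>w. N w \<le> v' \<Longrightarrow> z' - y + w \<in> K"
    using assms(2) by (auto simp: gap_set_def)
  have "z + z' - (x + y) + w \<in> K" if w: "N w \<le> v + v'" for w
  proof (cases "v + v' = 0")
    case True
    with s t w have "v = 0" "v' = 0" "w = 0"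
      using equivalent_norm_le_zero[OF N, of w] by auto
    then show ?thesis
      using add[OF ball[of 0] ball'[of 0]] equivalent_norm_zero[OF N] by (simp add: algebra_simps)
  next
    case False
    with s t have pos: "v + v' > 0" by simp
    have le: "N ((c / (v + v')) *\<^sub>R w) \<le> c" if "0 \<le> c" for c
    proof -
      have "N ((c / (v + v')) *\<^sub>R w) = (c / (v + v')) * N w"
        using that pos by (simp add: equivalent_norm_scaleR[OF N])
      also have "\<dots> \<le> (c / (v + v')) * (v + v')"
        using that pos w by (intro mult_left_mono) auto
      finally show ?thesis using pos by simp
    qed
    have "(v / (v + v')) *\<^sub>R w + (v' / (v + v')) *\<^sub>R w = w"
      using pos by (simp add: scaleR_add_left[symmetric] add_divide_distrib[symmetric])
    then have "z + z' - (x + y) + w =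
        (z - x + (v / (v + v')) *\<^sub>R w) + (z' - y + (v' / (v + v')) *\<^sub>R w)"
      by (simp add: algebra_simps)
    also have "\<dots> \<in> K"
      using s t by (intro add ball ball' le)
    finally show ?thesis .
  qed
  moreover have "N (z + z') \<le> u + u'"
    using equivalent_norm_triangle[OF N, of z z'] s t by simp
  ultimately show ?thesis
    unfolding gap_set_def mem_Collect_eq using s t
    by (intro exI[of _ "u + u'"] exI[of _ "v + v'"] conjI exI[of _ "z + z'"]) auto
qed

lemma gap_set_scaleR:
  assumes "s \<in> gap_set K N y" "0 < c"
  shows "c * s \<in> gap_set K N (c *\<^sub>R y)"
proof -
  obtain u v z where s: "s = u - v" "0 \<le> u" "0 \<le> v" "N z \<le> u"
    and ball: "\<And>w. N w \<le> v \<Longrightarrow> z - y + w \<in> K"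
    using assms(1) by (auto simp: gap_set_def)
  have "c *\<^sub>R z - c *\<^sub>R y + w \<in> K" if w: "N w \<le> c * v" for w
  proof -
    have "N (inverse c *\<^sub>R w) \<le> v"
      using w assms(2) by (simp add: equivalent_norm_scaleR[OF N] field_simps)
    then have "c *\<^sub>R (z - y + inverse c *\<^sub>R w) \<in> K"
      using assms(2) by (intro scaleR ball) auto
    then show ?thesis using assms(2) by (simp add: algebra_simps)
  qed
  moreover have "N (c *\<^sub>R z) \<le> c * u"
    using s assms(2) by (simp add: equivalent_norm_scaleR[OF N])
  ultimately show ?thesis
    unfolding gap_set_def mem_Collect_eq using s assms(2)
    by (intro exI[of _ "c * u"] exI[of _ "c * v"] conjI exI[of _ "c *\<^sub>R z"]) (auto simp: algebra_simps)
qed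

text \<open>Moving from \<open>y\<close> to the apex of the cone costs \<open>N y\<close>; hence the
  oriented distance is dominated by \<open>N\<close>.\<close>

lemma norm_in_gap_set: "N y \<in> gap_set K N y"
proof -
  have "w \<in> K" if "N w \<le> 0" for w
    using that equivalent_norm_le_zero[OF N, of w] zero by simp
  then have "N y - 0 \<in> gap_set K N y"
    unfolding gap_set_def mem_Collect_eq
    by (intro exI[of _ "N y"] exI[of _ 0] exI[of _ y] conjI) (auto simp: equivalent_norm_nonneg[OF N])
  then show ?thesis by simp
qed

lemma sublinear_Psi_HU: "sublinear (Psi_HU K N)"
  unfolding sublinear_def
proof (intro conjI allI impI)
  fix x y
  have *: "Psi_HU K N (x + y) - t \<le> s" if "s \<in> gap_set K N x" "t \<in> gap_set K N y" for s t
    using Psi_HU_le_gap[OF gap_set_add[OF that]] by simp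
  have "Psi_HU K N (x + y) - t \<le> Psi_HU K N x" if "t \<in> gap_set K N y" for t
    using * that by (intro le_Psi_HU) auto
  then have "Psi_HU K N (x + y) - Psi_HU K N x \<le> Psi_HU K N y"
    by (intro le_Psi_HU) (simp add: algebra_simps)
  then show "Psi_HU K N (x + y) \<le> Psi_HU K N x + Psi_HU K N y" by simp
next
  fix c :: real and y assume c: "0 \<le> c"
  show "Psi_HU K N (c *\<^sub>R y) \<le> c * Psi_HU K N y"
  proof (cases "c = 0")
    case True
    then show ?thesis
      using Psi_HU_le_gap[OF norm_in_gap_set[of 0]] by (simp add: equivalent_norm_zero[OF N])
  next
    case False
    with c have "c > 0" by simp
    then have "Psi_HU K N (c *\<^sub>R y) / c \<le> Psi_HU K N y"
      using Psi_HU_le_gap[OF gap_set_scaleR] by (intro le_Psi_HU) (simp add: field_simps)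
    then show ?thesis using \<open>c > 0\<close> by (simp add: field_simps)
  qed
qed

end

section \<open>The functionals below the oriented distance generate the dual cone\<close>

theorem Omega_HU_subset_Omega_DS: "Omega_HU K \<subseteq> Omega_DS K"
proof
  fix \<psi> assume "\<psi> \<in> Omega_HU K"
  then obtain N where N: "equivalent_norm N" and \<psi>: "\<psi> = Psi_HU K N"
    by (auto simp: Omega_HU_def)
  obtain a b where a: "a > 0" "\<And>x. a * norm x \<le> N x" and b: "b > 0" "\<And>x. N x \<le> b * norm x"
    using N by (auto simp: equivalent_norm_def)
  have sub: "sublinear \<psi>" unfolding \<psi> by (rule sublinear_Psi_HU[OF N])
  have \<psi>_le: "\<psi> y \<le> N y" for y
    unfolding \<psi> by (rule Psi_HU_le_gap[OF N norm_in_gap_set[OF N]])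
  define G where "G = {f. \<forall>y. blinfun_apply f y \<le> \<psi> y}"
  obtain r where "r \<in> interior K" using interior by blast
  then obtain e where e: "e > 0" "ball r e \<subseteq> K" by (auto simp: mem_interior)
  \<comment> \<open>The factor \<open>a\<close> turns an \<open>N\<close>-ball into a ball of the
    original norm; the half fits the closed ball into the open one.\<close>
  define \<delta> where "\<delta> = a * e / 2"
  have "\<delta> > 0" using a e by (simp add: \<delta>_def)
  have "\<psi> (- r) \<le> - \<delta>"
  proof -
    have "r + w \<in> K" if "N w \<le> \<delta>" for w
    proof -
      have "a * norm w \<le> a * e / 2" using that a(2)[of w] by (simp add: \<delta>_def)
      then have "norm w < e" using a(1) e(1) by simp
      then show ?thesis using e(2) by (intro subsetD[OF e(2)]) (simp add: dist_norm)
    qed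
    then have "0 - \<delta> \<in> gap_set K N (- r)"
      unfolding gap_set_def mem_Collect_eq using \<open>\<delta> > 0\<close>
      by (intro exI[of _ 0] exI[of _ \<delta>] conjI) (auto simp: equivalent_norm_zero[OF N])
    then show ?thesis unfolding \<psi> using Psi_HU_le_gap[OF N] by force
  qed
  then have G_r: "\<delta> \<le> blinfun_apply f r" if "f \<in> G" for f
    using that by (auto simp: G_def blinfun.minus_right dest!: spec[of _ "- r"])
  \<comment> \<open>The Hahn-Banach functional is below \<open>b * norm\<close>, hence bounded, so
    it is an element of \<open>G\<close>.\<close>
  have attained: "\<exists>f\<in>G. blinfun_apply f y = \<psi> y" for y
  proof -
    obtain g where g: "linear g" "\<And>x. g x \<le> \<psi> x" "g y = \<psi> y"
      using hahn_banach_sublinear[OF sub] by blast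
    have "bounded_linear g"
      using order_trans[OF order_trans[OF g(2) \<psi>_le] b(2)]
      by (intro linear_le_imp_bounded_linear[OF g(1)])
    with g show ?thesis
      by (intro bexI[of _ "Blinfun g"]) (auto simp: G_def bounded_linear_Blinfun_apply)
  qed
  have "generator K G"
    unfolding generator_def
  proof (intro conjI)
    show "convex G"
      unfolding convex_def
    proof (intro ballI allI impI)
      fix f g and u v :: real
      assume fg: "f \<in> G" "g \<in> G" and uv: "0 \<le> u" "0 \<le> v" "u + v = 1"
      have "u * blinfun_apply f y + v * blinfun_apply g y \<le> \<psi> y" for y
      proof -
        have "u * blinfun_apply f y + v * blinfun_apply g y \<le> u * \<psi> y + v * \<psi> y"
          using fg uv by (intro add_mono mult_left_mono) (auto simp: G_def)
        also have "\<dots> = \<psi> y" using uv by (simp add: distrib_right[symmetric])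
        finally show ?thesis .
      qed
      then show "u *\<^sub>R f + v *\<^sub>R g \<in> G" by (simp add: G_def blinfun.add_left blinfun.scaleR_left)
    qed
    show "0 \<notin> weak_star_topology closure_of G"
      using \<open>\<delta> > 0\<close> G_r by (rule zero_notin_weak_star_closure)
    show "dual_cone K = {t *\<^sub>R f | t f. 0 \<le> t \<and> f \<in> G}"
    proof (intro equalityI subsetI)
      fix h assume "h \<in> {t *\<^sub>R f | t f. 0 \<le> t \<and> f \<in> G}"
      then obtain t f where h: "h = t *\<^sub>R f" "0 \<le> t" "f \<in> G" by auto
      have "0 \<le> blinfun_apply f k" if "k \<in> K" for k
      proof -
        have "k + w \<in> K" if "N w \<le> 0" for w
          using that \<open>k \<in> K\<close> equivalent_norm_le_zero[OF N, of w]
          by simp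
        then have "0 - 0 \<in> gap_set K N (- k)"
          unfolding gap_set_def mem_Collect_eq
          by (intro exI[of _ 0] conjI) (auto simp: equivalent_norm_zero[OF N])
        then have "\<psi> (- k) \<le> 0" unfolding \<psi> using Psi_HU_le_gap[OF N] by force
        then show ?thesis
          using h(3) by (auto simp: G_def blinfun.minus_right dest!: spec[of _ "- k"])
      qed
      with h show "h \<in> dual_cone K" by (simp add: dual_cone_def blinfun.scaleR_left)
    next
      fix h assume h: "h \<in> dual_cone K"
      show "h \<in> {t *\<^sub>R f | t f. 0 \<le> t \<and> f \<in> G}"
      proof (cases "h = 0")
        case True
        obtain f where "f \<in> G" using attained by blast
        with True show ?thesis by (auto intro!: exI[of _ 0] exI[of _ f])
      next
        case False
        \<comment> \<open>Dividing by the norm dual to \<open>N\<close> puts \<open>h\<close> into \<open>G\<close>.\<close>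
        define B where "B = {z. N z \<le> 1}"
        define c where "c = (SUP z\<in>B. blinfun_apply h z)"
        have "blinfun_apply h z \<le> norm h * (1 / a)" if "z \<in> B" for z
        proof -
          have "norm z \<le> 1 / a" using a(2)[of z] that \<open>a > 0\<close> by (simp add: B_def field_simps)
          then have "norm h * norm z \<le> norm h * (1 / a)" by (intro mult_left_mono) auto
          with norm_blinfun[of h z] show ?thesis by simp
        qed
        then have "bdd_above (blinfun_apply h ` B)" by (rule bdd_aboveI2)
        then have h_le: "blinfun_apply h z \<le> c" if "N z \<le> 1" for z
          unfolding c_def using that by (intro cSUP_upper) (auto simp: B_def)
        have h_leN: "blinfun_apply h z \<le> c * N z" for z
        proof (cases "z = 0")
          case True
          then show ?thesis by (simp add: equivalent_norm_zero[OF N])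
        next
          case False
          then have "N z > 0"
            using equivalent_norm_eq_zero[OF N, of z] equivalent_norm_nonneg[OF N, of z] by simp
          then show ?thesis
            using h_le[of "inverse (N z) *\<^sub>R z"]
            by (simp add: equivalent_norm_scaleR[OF N] blinfun.scaleR_right field_simps)
        qed
        have "c > 0"
        proof -
          obtain x where "blinfun_apply h x \<noteq> 0" using False by (metis blinfun_eqI zero_blinfun.rep_eq)
          then obtain y where "blinfun_apply h y > 0"
            by (metis blinfun.minus_right linorder_neqE_linordered_idom neg_0_less_iff_less)
          with h_leN[of y] have "0 < c * N y" by simp
          then show ?thesis
            using equivalent_norm_nonneg[OF N, of y] by (simp add: zero_less_mult_iff)
        qed
        \<comment> \<open>Since \<open>h\<close> is nonnegative on the \<open>v\<close>-ball around
          \<open>z - y\<close>, its value at the centre is at least \<open>c * v\<close>; subtract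
          this from \<open>h z \<le> c * u\<close>.\<close>
        have "blinfun_apply h y \<le> c * s" if gap: "s \<in> gap_set K N y" for y s
        proof -
          obtain u v z where s: "s = u - v" "0 \<le> u" "0 \<le> v" "N z \<le> u"
            and ball: "\<And>w. N w \<le> v \<Longrightarrow> z - y + w \<in> K"
            using gap by (auto simp: gap_set_def)
          have "c * v \<le> blinfun_apply h (z - y)"
          proof (cases "v = 0")
            case True
            then show ?thesis
              using ball[of 0] h equivalent_norm_zero[OF N] by (simp add: dual_cone_def)
          next
            case False
            with s have "v > 0" by simp
            have "blinfun_apply h w \<le> blinfun_apply h (z - y) / v" if "w \<in> B" for w
            proof -
              have "N (- v *\<^sub>R w) \<le> v"
                using that \<open>v > 0\<close> unfolding equivalent_norm_scaleR[OF N]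
                by (simp add: B_def mult_left_le)
              from ball[OF this] h have "0 \<le> blinfun_apply h (z - y + - v *\<^sub>R w)"
                unfolding dual_cone_def by blast
              then show ?thesis
                using \<open>v > 0\<close> by (simp add: blinfun.add_right blinfun.diff_right blinfun.scaleR_right field_simps)
            qed
            then have "c \<le> blinfun_apply h (z - y) / v"
              unfolding c_def
              by (intro cSUP_least) (auto simp: B_def equivalent_norm_zero[OF N] intro: exI[of _ 0])
            then show ?thesis using \<open>v > 0\<close> by (simp add: field_simps)
          qed
          moreover have "blinfun_apply h z \<le> c * u"
            using h_leN[of z] s \<open>c > 0\<close> by (meson mult_left_mono less_imp_le order_trans)
          ultimately show ?thesis
            by (simp add: s blinfun.diff_right algebra_simps)
        qed
        then have "blinfun_apply h y / c \<le> \<psi> y" for y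
          unfolding \<psi> using \<open>c > 0\<close> by (intro le_Psi_HU[OF N]) (simp add: field_simps)
        then have "inverse c *\<^sub>R h \<in> G"
          by (simp add: G_def blinfun.scaleR_left field_simps)
        then show ?thesis
          using \<open>c > 0\<close> by (auto intro!: exI[of _ c] exI[of _ "inverse c *\<^sub>R h"])
      qed
    qed
  qed
  moreover have "compactin weak_star_topology G"
    unfolding G_def by (rule compactin_weak_star_dominated[OF order_trans[OF \<psi>_le b(2)]])
  moreover have "Psi_DS G = \<psi>"
  proof
    fix y
    obtain f where "f \<in> G" "blinfun_apply f y = \<psi> y" using attained by blast
    then show "Psi_DS G y = \<psi> y"
      unfolding Psi_DS_def by (intro Greatest_equality) (auto simp: G_def)
  qed
  ultimately show "\<psi> \<in> Omega_DS K" by (auto simp: Omega_DS_def)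
qed

subsection \<open>Gerstewitz functionals\<close>

text \<open>Scaling a ball of radius \<open>e\<close> around \<open>r\<close> inside
  \<open>K\<close> by \<open>t\<close> gives radius \<open>t * e\<close> around
  \<open>t *\<^sub>R r\<close>, so \<open>C\<close> is the inverse of \<open>e\<close>.\<close>

lemma interior_absorbs:
  assumes "r \<in> interior K"
  obtains C where "0 < C" "\<And>t y. C * norm y \<le> t \<Longrightarrow> t *\<^sub>R r - y \<in> K"
proof -
  obtain e where e: "e > 0" "cball r e \<subseteq> K" using assms by (auto simp: mem_interior_cball)
  have "t *\<^sub>R r - y \<in> K" if "inverse e * norm y \<le> t" for t y
  proof (cases "t > 0")
    case True
    then have "norm y / t \<le> e" using that e(1) by (simp add: field_simps)
    then have "r - inverse t *\<^sub>R y \<in> K"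
      using True by (intro subsetD[OF e(2)]) (simp add: dist_norm divide_inverse mult.commute)
    then have "t *\<^sub>R (r - inverse t *\<^sub>R y) \<in> K" using True by (intro scaleR) auto
    then show ?thesis using True by (simp add: algebra_simps)
  next
    case False
    moreover have "0 \<le> inverse e * norm y" using e(1) by simp
    ultimately have "t = 0" "inverse e * norm y = 0" using that by linarith+
    then show ?thesis using e(1) zero by simp
  qed
  with e(1) that[of "inverse e"] show ?thesis by simp
qed

text \<open>Otherwise pointedness gives \<open>r = 0\<close>, and a cone with 0 in its interior is
  the whole space.\<close>

lemma minus_interior_notin:
  assumes "r \<in> interior K"
  shows "- r \<notin> K"
proof
  assume "- r \<in> K"
  then have "r = 0" using assms interior_subset pointed by blast
  obtain C where "\<And>t y. C * norm y \<le> t \<Longrightarrow> t *\<^sub>R r - y \<in> K"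
    using interior_absorbs[OF assms] by blast
  from this[of "- y" "C * norm (- y)" for y] have "y \<in> K" for y by (simp add: \<open>r = 0\<close>)
  with proper show False by blast
qed

text \<open>For very negative \<open>t\<close>, dividing by \<open>- t\<close> would put a point of
  \<open>K\<close> into a ball around \<open>- r\<close> that misses \<open>K\<close>.\<close>

lemma level_bounded_below:
  assumes "r \<in> interior K"
  obtains D where "\<And>t y. t *\<^sub>R r - y \<in> K \<Longrightarrow> - (D * norm y) \<le> t"
proof -
  have "open (- K)" "- r \<in> - K" using closed minus_interior_notin[OF assms] by auto
  then obtain d where d: "d > 0" "ball (- r) d \<subseteq> - K" by (meson openE)
  have "- (inverse d * norm y) \<le> t" if "t *\<^sub>R r - y \<in> K" for t y
  proof (rule ccontr)
    assume "\<not> ?thesis"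
    then have t: "inverse d * norm y < - t" by simp
    moreover have "0 \<le> inverse d * norm y" using d(1) by simp
    ultimately have "t < 0" by linarith
    have "inverse (- t) *\<^sub>R (t *\<^sub>R r - y) \<in> K" using \<open>t < 0\<close> that by (intro scaleR) auto
    moreover have "inverse (- t) *\<^sub>R (t *\<^sub>R r - y) = - r + inverse t *\<^sub>R y"
      using \<open>t < 0\<close> by (simp add: algebra_simps)
    moreover have "norm (inverse t *\<^sub>R y) < d"
      using t \<open>t < 0\<close> d(1) by (simp add: field_simps)
    then have "- r + inverse t *\<^sub>R y \<in> ball (- r) d" by (simp add: dist_norm)
    ultimately show False using d(2) by auto
  qed
  then show ?thesis by (rule that)
qed

context
  fixes r assumes r: "r \<in> interior K"
begin

text \<open>The set of levels \<open>t\<close> is nonempty, bounded below, closed and closed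
  upwards, so it is a half-line that contains its infimum.\<close>

lemma Psi_GW_le_iff: "Psi_GW K r y \<le> t \<longleftrightarrow> t *\<^sub>R r - y \<in> K"
proof -
  define S where "S = {t. t *\<^sub>R r - y \<in> K}"
  have mem: "t *\<^sub>R r \<in> {y + k | k. k \<in> K} \<longleftrightarrow> t \<in> S" for t
    unfolding S_def by (auto simp: algebra_simps) (metis add_diff_cancel_left' diff_add_cancel add.commute)
  obtain C where "t *\<^sub>R r - y \<in> K" if "C * norm y \<le> t" for t
    using interior_absorbs[OF r] by metis
  then have ne: "S \<noteq> {}" unfolding S_def by blast
  obtain D where "t *\<^sub>R r - y \<in> K \<Longrightarrow> - (D * norm y) \<le> t" for t
    using level_bounded_below[OF r] by metis
  then have bdd: "bdd_below S" unfolding S_def by (intro bdd_belowI) auto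
  have "S = (\<lambda>t. t *\<^sub>R r - y) -` K" by (auto simp: S_def)
  then have "closed S"
    using closed by (auto intro!: closed_vimage continuous_intros)
  then have "Inf S \<in> S" using closed_contains_Inf[OF ne bdd] by simp
  then have P: "Psi_GW K r y = Inf S"
    unfolding Psi_GW_def mem by (intro Least_equality) (auto intro: cInf_lower bdd)
  have "t \<in> S" if "Inf S \<le> t" for t
  proof -
    have "(Inf S *\<^sub>R r - y) + (t - Inf S) *\<^sub>R r \<in> K"
      using \<open>Inf S \<in> S\<close> that r interior_subset by (intro add scaleR) (auto simp: S_def)
    then show ?thesis by (simp add: S_def algebra_simps)
  qed
  then have "Psi_GW K r y \<le> t \<longleftrightarrow> t \<in> S"
    unfolding P using cInf_lower[OF _ bdd] by blast
  then show ?thesis by (simp add: S_def)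
qed

lemma Psi_GW_mem: "Psi_GW K r y *\<^sub>R r - y \<in> K"
  using Psi_GW_le_iff by blast

lemma sublinear_Psi_GW: "sublinear (Psi_GW K r)"
  unfolding sublinear_def
proof (intro conjI allI impI)
  fix x y
  have "(Psi_GW K r x *\<^sub>R r - x) + (Psi_GW K r y *\<^sub>R r - y) \<in> K"
    by (intro add Psi_GW_mem)
  then show "Psi_GW K r (x + y) \<le> Psi_GW K r x + Psi_GW K r y"
    by (simp add: Psi_GW_le_iff algebra_simps)
next
  fix c :: real and y assume "0 \<le> c"
  then have "c *\<^sub>R (Psi_GW K r y *\<^sub>R r - y) \<in> K"
    by (intro scaleR Psi_GW_mem)
  then show "Psi_GW K r (c *\<^sub>R y) \<le> c * Psi_GW K r y"
    by (simp add: Psi_GW_le_iff algebra_simps)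
qed

lemma Psi_GW_self: "Psi_GW K r r = 1"
proof -
  have "Psi_GW K r r \<le> 1" "Psi_GW K r (- r) \<le> - 1" by (simp_all add: Psi_GW_le_iff zero)
  then show ?thesis
    using sublinear_minus[OF sublinear_Psi_GW, of r] by simp
qed

lemma ex_equivalent_norm_dominating_Psi_GW:
  obtains N where "equivalent_norm N" "N r = 1" "\<And>y. Psi_GW K r y \<le> N y"
proof -
  define P where "P = Psi_GW K r"
  have P: "sublinear P" and P1: "P r = 1"
    by (simp_all add: P_def sublinear_Psi_GW Psi_GW_self)
  \<comment> \<open>The gauge of the order interval between \<open>- r\<close> and
    \<open>r\<close>.\<close>
  define p where "p y = max (P y) (P (- y))" for y
  \<comment> \<open>With \<open>f r = 1\<close>, the map taking \<open>y\<close> to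
    \<open>f y *\<^sub>R r\<close> is a projection onto the line through \<open>r\<close>,
    controlled by \<open>p\<close>.\<close>
  obtain f where f: "linear f" "\<And>y. f y \<le> P y" "f r = 1"
    using hahn_banach_sublinear[OF P, of r] P1 by metis
  have f_le: "\<bar>f y\<bar> \<le> p y" for y
    using f(2)[of y] f(2)[of "- y"] by (auto simp: p_def linear_neg[OF f(1)])
  obtain C where C: "0 < C" "\<And>t y. C * norm y \<le> t \<Longrightarrow> t *\<^sub>R r - y \<in> K"
    using interior_absorbs[OF r] by blast
  have P_le: "P y \<le> C * norm y" for y
    by (simp add: P_def Psi_GW_le_iff C(2))
  have p_le: "p y \<le> C * norm y" for y
    using P_le[of y] P_le[of "- y"] by (simp add: p_def)
  have p_add: "p (x + y) \<le> p x + p y" for x y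
    using sublinear_add[OF P, of x y] sublinear_add[OF P, of "- x" "- y"]
    unfolding p_def minus_add_distrib by (intro max.boundedI) linarith+
  have p_scale: "p (c *\<^sub>R y) = \<bar>c\<bar> * p y" for c y
  proof (cases "0 \<le> c")
    case True
    then show ?thesis
      using sublinear_scaleR[OF P, of c y] sublinear_scaleR[OF P, of c "- y"]
      by (simp add: p_def max_mult_distrib_left)
  next
    case False
    then show ?thesis
      using sublinear_scaleR[OF P, of "- c" y] sublinear_scaleR[OF P, of "- c" "- y"]
      by (simp add: p_def max_mult_distrib_left max.commute)
  qed
  \<comment> \<open>For a normal cone \<open>p\<close> alone would do. The second term vanishes at \<open>r\<close> and restores the lower
    bound in general.\<close>
  define N where "N y = max (p y) (norm (y - f y *\<^sub>R r))" for y
  have norm_le: "norm y \<le> (1 + norm r) * N y" for y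
  proof -
    have "norm y \<le> norm (y - f y *\<^sub>R r) + norm (f y *\<^sub>R r)"
      by (metis diff_add_cancel norm_triangle_ineq)
    also have "\<dots> \<le> N y + N y * norm r"
    proof (intro add_mono)
      show "norm (y - f y *\<^sub>R r) \<le> N y" by (simp add: N_def)
      have "\<bar>f y\<bar> \<le> N y" using f_le[of y] by (simp add: N_def le_max_iff_disj)
      then show "norm (f y *\<^sub>R r) \<le> N y * norm r" by (simp add: mult_right_mono)
    qed
    finally show ?thesis by (simp add: algebra_simps)
  qed
  have pos: "0 < 1 + norm r" by (simp add: add_pos_nonneg)
  have "equivalent_norm N"
    unfolding equivalent_norm_def
  proof (intro conjI allI)
    fix x
    show "N x = 0 \<longleftrightarrow> x = 0"
    proof
      assume "N x = 0"
      with norm_le[of x] show "x = 0" by simp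
    next
      assume "x = 0"
      then show "N x = 0"
        using linear_0[OF f(1)] sublinear_zero[OF P] by (simp add: N_def p_def)
    qed
  next
    fix c x
    have "norm (c *\<^sub>R x - f (c *\<^sub>R x) *\<^sub>R r) = \<bar>c\<bar> * norm (x - f x *\<^sub>R r)"
      unfolding norm_scaleR[symmetric] by (simp add: linear_scale[OF f(1)] algebra_simps)
    then show "N (c *\<^sub>R x) = \<bar>c\<bar> * N x"
      by (simp add: N_def p_scale max_mult_distrib_left)
  next
    fix x y
    have "norm (x + y - f (x + y) *\<^sub>R r) \<le> norm (x - f x *\<^sub>R r) + norm (y - f y *\<^sub>R r)"
      using norm_triangle_ineq[of "x - f x *\<^sub>R r" "y - f y *\<^sub>R r"]
      by (simp add: linear_add[OF f(1)] algebra_simps)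
    with p_add[of x y] show "N (x + y) \<le> N x + N y"
      unfolding N_def by (intro max.boundedI) linarith+
  next
    have "N x \<le> (1 + C + C * norm r) * norm x" for x
    proof -
      have "norm (x - f x *\<^sub>R r) \<le> norm x + \<bar>f x\<bar> * norm r"
        using norm_triangle_ineq4[of x "f x *\<^sub>R r"] by simp
      also have "\<dots> \<le> norm x + (C * norm x) * norm r"
        by (intro add_mono mult_right_mono order_trans[OF f_le p_le]) auto
      finally have "norm (x - f x *\<^sub>R r) \<le> norm x + C * norm x * norm r" .
      moreover have "0 \<le> C * norm x" "0 \<le> C * norm x * norm r" using C(1) by simp_all
      moreover have "(1 + C + C * norm r) * norm x = norm x + C * norm x + C * norm x * norm r"
        by (simp add: algebra_simps)
      ultimately show ?thesis
        using p_le[of x] norm_ge_zero[of x] unfolding N_def by (intro max.boundedI) linarith+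
    qed
    moreover have "inverse (1 + norm r) * norm x \<le> N x" for x
      using norm_le[of x] pos by (simp add: field_simps)
    moreover have "0 < 1 + C + C * norm r" using C(1) by (simp add: add_pos_nonneg)
    ultimately show "\<exists>a>0. \<exists>b>0. \<forall>x. a * norm x \<le> N x \<and> N x \<le> b * norm x"
      using pos by (intro exI[of _ "inverse (1 + norm r)"] exI[of _ "1 + C + C * norm r"] conjI allI) auto
  qed
  moreover have "P (- r) \<le> 1"
    unfolding P_def Psi_GW_le_iff
    using add[of r r] r interior_subset by auto
  then have "N r = 1" by (simp add: N_def p_def P1 f(3))
  moreover have "Psi_GW K r y \<le> N y" for y by (simp add: N_def p_def P_def)
  ultimately show ?thesis by (rule that)
qed

text \<open>A nonnegative value is realized by moving along \<open>r\<close>, where \<open>N\<close>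
  measures the parameter. A negative one is realized by a ball around \<open>y\<close>, which stays
  in \<open>- K\<close> because \<open>N\<close> dominates the functional. For the lower bound, the
  perturbation \<open>- v *\<^sub>R r\<close> is tested.\<close>

lemma Psi_GW_eq_Psi_HU:
  assumes N: "equivalent_norm N" and Nr: "N r = 1" and le: "\<And>y. Psi_GW K r y \<le> N y"
  shows "Psi_GW K r = Psi_HU K N"
proof
  fix y
  let ?t = "Psi_GW K r y"
  have "?t \<in> gap_set K N y"
  proof (cases "0 \<le> ?t")
    case True
    have "?t *\<^sub>R r - y + w \<in> K" if "N w \<le> 0" for w
      using that Psi_GW_mem[of y] by (simp add: equivalent_norm_le_zero[OF N])
    then have "?t - 0 \<in> gap_set K N y"
      unfolding gap_set_def mem_Collect_eq using True
      by (intro exI[of _ ?t] exI[of _ 0] exI[of _ "?t *\<^sub>R r"] conjI)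
         (auto simp: equivalent_norm_scaleR[OF N] Nr)
    then show ?thesis by simp
  next
    case False
    have "0 - y + w \<in> K" if "N w \<le> - ?t" for w
    proof -
      have "Psi_GW K r (y + - w) \<le> ?t + Psi_GW K r (- w)"
        by (rule sublinear_add[OF sublinear_Psi_GW])
      also have "\<dots> \<le> ?t + N w" using le[of "- w"] by (simp add: equivalent_norm_minus[OF N])
      finally have "Psi_GW K r (y - w) \<le> 0" using that by simp
      then show ?thesis by (simp add: Psi_GW_le_iff)
    qed
    then have "0 - (- ?t) \<in> gap_set K N y"
      unfolding gap_set_def mem_Collect_eq using False
      by (intro exI[of _ 0] exI[of _ "- ?t"] conjI)
         (auto simp: equivalent_norm_zero[OF N] simp del: diff_0)
    then show ?thesis by simp
  qed
  moreover have "?t \<le> s" if gap: "s \<in> gap_set K N y" for s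
  proof -
    obtain u v z where s: "s = u - v" "0 \<le> v" "N z \<le> u"
      and ball: "\<And>w. N w \<le> v \<Longrightarrow> z - y + w \<in> K"
      using gap by (auto simp: gap_set_def)
    have "N ((- v) *\<^sub>R r) \<le> v"
      using s(2) unfolding equivalent_norm_scaleR[OF N] Nr by simp
    then have "z - y + (- v) *\<^sub>R r \<in> K" by (rule ball)
    then have "Psi_GW K r (y - z) \<le> - v" by (simp add: Psi_GW_le_iff algebra_simps)
    moreover have "?t \<le> Psi_GW K r z + Psi_GW K r (y - z)"
      using sublinear_add[OF sublinear_Psi_GW, of z "y - z"] by simp
    ultimately show ?thesis using le[of z] s by simp
  qed
  ultimately show "?t = Psi_HU K N y" using Psi_HU_eqI[OF N] by metis
qed

end

theorem Omega_GW_subset_Omega_HU: "Omega_GW K \<subseteq> Omega_HU K"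
proof
  fix \<psi> assume "\<psi> \<in> Omega_GW K"
  then obtain r where r: "r \<in> interior K" and \<psi>: "\<psi> = Psi_GW K r"
    by (auto simp: Omega_GW_def)
  obtain N where N: "equivalent_norm N" "N r = 1" "\<And>y. Psi_GW K r y \<le> N y"
    using ex_equivalent_norm_dominating_Psi_GW[OF r] by blast
  from Psi_GW_eq_Psi_HU[OF r N] N(1) show "\<psi> \<in> Omega_HU K"
    by (auto simp: Omega_HU_def \<psi>)
qed

end

lemma admissible_imp_proper_cone:
  assumes "admissible K"
  shows "proper_cone K"
proof
  have K: "closed K" "convex K \<and> cone K" "pointed K" "interior K \<noteq> {}"
    using assms by (auto simp: admissible_def)
  show "closed K" "interior K \<noteq> {}" by fact+
  show "x + y \<in> K" if "x \<in> K" "y \<in> K" for x y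
    using K(2) that unfolding convex_cone by blast
  show "c *\<^sub>R x \<in> K" if "x \<in> K" "0 \<le> c" for x c
    using K(2) that unfolding convex_cone by blast
  show pt: "x = 0" if "x \<in> K" "- x \<in> K" for x
    using K(3) that unfolding pointed_def by (metis IntI image_eqI minus_minus singletonD)
  show "K \<noteq> UNIV"
    using assms pt by (auto simp: admissible_def)
qed

subsection \<open>The quadrant in the plane\<close>

text \<open>An element of the bidual is evaluation at the vector whose coordinates are its values on
  the coordinate functionals.\<close>

lemma reflexive_space_euclidean: "reflexive_space TYPE('a::euclidean_space)"
  unfolding reflexive_space_def
proof
  fix \<phi> :: "('a \<Rightarrow>\<^sub>L real) \<Rightarrow>\<^sub>L real"
  let ?y = "\<Sum>b\<in>Basis. blinfun_apply \<phi> (blinfun_inner_right b) *\<^sub>R b"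
  have "blinfun_apply \<phi> f = blinfun_apply f ?y" for f
  proof -
    have "f = (\<Sum>b\<in>Basis. blinfun_apply f b *\<^sub>R blinfun_inner_right b)"
    proof (rule blinfun_eqI)
      fix x
      have "blinfun_apply f x = blinfun_apply f (\<Sum>b\<in>Basis. (x \<bullet> b) *\<^sub>R b)"
        by (simp add: euclidean_representation)
      also have "\<dots> = blinfun_apply (\<Sum>b\<in>Basis. blinfun_apply f b *\<^sub>R blinfun_inner_right b) x"
        by (simp add: blinfun.sum_right blinfun.sum_left blinfun.scaleR_right blinfun.scaleR_left
            inner_commute mult.commute)
      finally show "blinfun_apply f x = \<dots>" .
    qed
    then have "blinfun_apply \<phi> f = blinfun_apply \<phi> (\<Sum>b\<in>Basis. blinfun_apply f b *\<^sub>R blinfun_inner_right b)"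
      by simp
    also have "\<dots> = blinfun_apply f ?y"
      by (simp add: blinfun.sum_right blinfun.scaleR_right mult.commute)
    finally show ?thesis .
  qed
  then show "\<exists>y. \<forall>f. blinfun_apply \<phi> f = blinfun_apply f y" by blast
qed

definition quadrant :: "(real^2) set" where
  "quadrant = {v. 0 \<le> v $ 1 \<and> 0 \<le> v $ 2}"

lemma vector_add: "vector [a, b] + vector [c, d] = (vector [a + c, b + d] :: real^2)"
  and vector_scaleR: "t *\<^sub>R vector [a, b] = (vector [t * a, t * b] :: real^2)"
  by (simp_all add: vec_eq_iff forall_2)

lemma inner_vector: "vector [a, b] \<bullet> (v :: real^2) = a * v $ 1 + b * v $ 2"
  by (simp add: inner_vec_def sum_2)

lemma admissible_quadrant: "admissible quadrant"
  unfolding admissible_def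
proof (intro conjI)
  have "(1 :: real^2) \<noteq> 0" by simp
  then show "\<exists>y :: real^2. y \<noteq> 0" ..
  show "closed quadrant"
    unfolding quadrant_def by (intro closed_Collect_conj closed_Collect_le continuous_intros)
  have "convex quadrant \<and> cone quadrant"
    unfolding convex_cone by (auto simp: quadrant_def)
  then show "convex quadrant" "cone quadrant" by auto
  have "v = 0" if "v \<in> quadrant" "w \<in> quadrant" "v = - w" for v w
    using that by (auto simp: quadrant_def vec_eq_iff forall_2)
  moreover have "0 \<in> quadrant" by (simp add: quadrant_def)
  moreover from this have "- 0 \<in> uminus ` quadrant" by (rule imageI)
  ultimately show "pointed quadrant" unfolding pointed_def by auto
  have "open {v :: real^2. 0 < v $ 1 \<and> 0 < v $ 2}"
    by (intro open_Collect_conj open_Collect_less continuous_intros)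
  then have "{v :: real^2. 0 < v $ 1 \<and> 0 < v $ 2} \<subseteq> interior quadrant"
    by (intro interior_maximal) (auto simp: quadrant_def)
  moreover have "vector [1, 1] \<in> {v :: real^2. 0 < v $ 1 \<and> 0 < v $ 2}" by simp
  ultimately show "interior quadrant \<noteq> {}" by blast
  show "reflexive_space TYPE(real^2) \<or> normal_cone quadrant"
    using reflexive_space_euclidean by blast
qed

interpretation quadrant: proper_cone quadrant
  by (rule admissible_imp_proper_cone[OF admissible_quadrant])

section \<open>An oriented distance that is no Gerstewitz functional\<close>

definition norm_l1 :: "real^2 \<Rightarrow> real" where
  "norm_l1 v = \<bar>v $ 1\<bar> + \<bar>v $ 2\<bar>"

lemma equivalent_norm_l1: "equivalent_norm norm_l1"
  unfolding equivalent_norm_def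
proof (intro conjI allI)
  fix x y :: "real^2" and c :: real
  show "norm_l1 x = 0 \<longleftrightarrow> x = 0" by (auto simp: norm_l1_def vec_eq_iff forall_2)
  show "norm_l1 (c *\<^sub>R x) = \<bar>c\<bar> * norm_l1 x" by (simp add: norm_l1_def abs_mult distrib_left)
  show "norm_l1 (x + y) \<le> norm_l1 x + norm_l1 y" by (simp add: norm_l1_def)
next
  have "norm x \<le> norm_l1 x" for x
    using norm_le_l1_cart[of x] by (simp add: norm_l1_def sum_2)
  moreover have "norm_l1 x \<le> 2 * norm x" for x
    using component_le_norm_cart[of x 1] component_le_norm_cart[of x 2] by (simp add: norm_l1_def)
  ultimately show "\<exists>a>0. \<exists>b>0. \<forall>x. a * norm x \<le> norm_l1 x \<and> norm_l1 x \<le> b * norm x"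
    by (intro exI[of _ 1] conjI exI[of _ 2]) auto
qed

lemma Psi_HU_norm_l1:
  assumes "y \<in> quadrant"
  shows "Psi_HU quadrant norm_l1 y = y $ 1 + y $ 2"
proof -
  have y: "norm_l1 y = y $ 1 + y $ 2" using assms by (simp add: norm_l1_def quadrant_def)
  have "norm_l1 y \<le> s" if gap: "s \<in> gap_set quadrant norm_l1 y" for s
  proof -
    obtain u v z where s: "s = u - v" "0 \<le> v" "norm_l1 z \<le> u"
      and ball: "\<And>w. norm_l1 w \<le> v \<Longrightarrow> z - y + w \<in> quadrant"
      using gap by (auto simp: gap_set_def)
    \<comment> \<open>Spending the whole radius on one coordinate gives
      \<open>z $ 1 \<ge> y $ 1 + v\<close> and \<open>z $ 2 \<ge> y $ 2\<close>; the sum bounds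
      \<open>u - v\<close> from below.\<close>
    have "z - y + vector [- v, 0] \<in> quadrant"
      using s by (intro ball) (simp add: norm_l1_def)
    then show ?thesis using s unfolding y by (auto simp: quadrant_def norm_l1_def)
  qed
  then have "Psi_HU quadrant norm_l1 y = norm_l1 y"
    using quadrant.norm_in_gap_set[OF equivalent_norm_l1]
    by (intro quadrant.Psi_HU_eqI[OF equivalent_norm_l1]) auto
  with y show ?thesis by simp
qed

text \<open>The value 1 at both unit vectors forces both coordinates of \<open>r\<close> to be at
  least 1, which caps the value at (1, 1) by 1 instead of 2.\<close>

lemma Psi_HU_norm_l1_notin_Omega_GW: "Psi_HU quadrant norm_l1 \<notin> Omega_GW quadrant"
proof
  assume "Psi_HU quadrant norm_l1 \<in> Omega_GW quadrant"
  then obtain r where r: "r \<in> interior quadrant" and eq: "Psi_HU quadrant norm_l1 = Psi_GW quadrant r"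
    by (auto simp: Omega_GW_def)
  have iff: "y $ 1 + y $ 2 \<le> t \<longleftrightarrow> t *\<^sub>R r - y \<in> quadrant" if "y \<in> quadrant" for y t
    using quadrant.Psi_GW_le_iff[OF r, of y t] Psi_HU_norm_l1[OF that] by (simp add: eq)
  have "1 \<le> r $ 1"
    using iff[of "vector [1, 0]" 1] by (simp add: quadrant_def)
  moreover have "1 \<le> r $ 2"
    using iff[of "vector [0, 1]" 1] by (simp add: quadrant_def)
  ultimately show False
    using iff[of "vector [1, 1]" 1] by (simp add: quadrant_def)
qed

section \<open>A support function that is no oriented distance\<close>

text \<open>The vertex \<open>(1/3, 1/3)\<close> lies strictly between the origin and the segment from \<open>(1, 0)\<close> to
  \<open>(0, 1)\<close>, whereas the unit sphere of a dual norm bulges away from the origin.\<close>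

definition triangle :: "(real^2) set" where
  "triangle = convex hull {vector [1, 0], vector [0, 1], vector [1/3, 1/3]}"

lemma triangle_eq:
  "triangle = {vector [u + w / 3, v + w / 3] | u v w. 0 \<le> u \<and> 0 \<le> v \<and> 0 \<le> w \<and> u + v + w = 1}"
  unfolding triangle_def convex_hull_3 by (simp add: vector_scaleR vector_add)

definition triangle_functionals :: "((real^2) \<Rightarrow>\<^sub>L real) set" where
  "triangle_functionals = blinfun_inner_right ` triangle"

text \<open>Every ray of the quadrant meets the side from (1, 0) to (0, 1), and evaluation at (1, 1)
  keeps the triangle away from 0.\<close>

lemma generator_triangle_functionals: "generator quadrant triangle_functionals"
  unfolding generator_def
proof (intro conjI)
  show "convex triangle_functionals"
    unfolding triangle_functionals_def triangle_def
    by (intro convex_linear_image convex_convex_hull bounded_linear.linear bounded_linear_blinfun_inner_right)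
  have "1 / 3 \<le> blinfun_apply f (vector [1, 1])" if "f \<in> triangle_functionals" for f
    using that by (auto simp: triangle_functionals_def triangle_eq inner_vector)
  then show "0 \<notin> weak_star_topology closure_of triangle_functionals"
    by (intro zero_notin_weak_star_closure[of "1 / 3"]) auto
  show "dual_cone quadrant = {t *\<^sub>R f | t f. 0 \<le> t \<and> f \<in> triangle_functionals}"
  proof (intro equalityI subsetI)
    fix h assume "h \<in> {t *\<^sub>R f | t f. 0 \<le> t \<and> f \<in> triangle_functionals}"
    then show "h \<in> dual_cone quadrant"
      by (auto simp: dual_cone_def triangle_functionals_def triangle_eq inner_vector quadrant_def
          blinfun.scaleR_left)
  next
    fix h assume h: "h \<in> dual_cone quadrant"
    define a b where "a = blinfun_apply h (vector [1, 0])" and "b = blinfun_apply h (vector [0, 1])"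
    have ab: "0 \<le> a" "0 \<le> b" using h by (simp_all add: a_def b_def dual_cone_def quadrant_def)
    have h_eq: "h = blinfun_inner_right (vector [a, b])"
    proof (rule blinfun_eqI)
      fix x :: "real^2"
      have "x = x $ 1 *\<^sub>R vector [1, 0] + x $ 2 *\<^sub>R vector [0, 1]"
        by (simp add: vec_eq_iff forall_2)
      then have "blinfun_apply h x = blinfun_apply h (x $ 1 *\<^sub>R vector [1, 0] + x $ 2 *\<^sub>R vector [0, 1])"
        by simp
      then show "blinfun_apply h x = blinfun_apply (blinfun_inner_right (vector [a, b])) x"
        by (simp only: blinfun.add_right blinfun.scaleR_right)
           (simp add: inner_vector a_def b_def mult.commute)
    qed
    have mem: "blinfun_inner_right (vector [c, d]) \<in> triangle_functionals"
      if "0 \<le> c" "0 \<le> d" "c + d = 1" for c d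
      using that unfolding triangle_functionals_def triangle_eq
      by (intro imageI CollectI exI[of _ c] exI[of _ d] exI[of _ 0]) simp
    show "h \<in> {t *\<^sub>R f | t f. 0 \<le> t \<and> f \<in> triangle_functionals}"
    proof (cases "a + b = 0")
      case True
      with ab have "a = 0" "b = 0" by auto
      then have "h = 0 *\<^sub>R blinfun_inner_right (vector [1, 0])"
        unfolding h_eq by (intro blinfun_eqI) (simp add: inner_vector)
      with mem[of 1 0] show ?thesis by (intro CollectI exI conjI) auto
    next
      case False
      with ab have "0 < a + b" by simp
      have "h = (a + b) *\<^sub>R blinfun_inner_right (vector [a / (a + b), b / (a + b)])"
      proof (rule blinfun_eqI)
        fix x :: "real^2"
        have "vector [a, b] = (a + b) *\<^sub>R (vector [a / (a + b), b / (a + b)] :: real^2)"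
          using \<open>0 < a + b\<close> by (simp add: vector_scaleR)
        then show "blinfun_apply h x =
            blinfun_apply ((a + b) *\<^sub>R blinfun_inner_right (vector [a / (a + b), b / (a + b)])) x"
          by (simp only: h_eq blinfun.scaleR_left blinfun_inner_right.rep_eq inner_scaleR_left) simp
      qed
      moreover have "blinfun_inner_right (vector [a / (a + b), b / (a + b)]) \<in> triangle_functionals"
        using ab \<open>0 < a + b\<close> by (intro mem) (auto simp: add_divide_distrib[symmetric])
      ultimately show ?thesis using \<open>0 < a + b\<close> by (intro CollectI exI conjI) auto
    qed
  qed
qed

lemma compactin_triangle_functionals: "compactin weak_star_topology triangle_functionals"
  unfolding triangle_functionals_def
proof (rule image_compactin)
  show "compactin euclidean triangle"
    by (simp add: triangle_def finite_imp_compact_convex_hull)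
  show "continuous_map euclidean weak_star_topology (blinfun_inner_right :: real^2 \<Rightarrow> _)"
    unfolding continuous_on_strong_operator_topo_iff_coordinatewise
    by (auto intro!: continuous_intros)
qed

lemma Psi_DS_eqI:
  assumes "f \<in> G" "blinfun_apply f y = t" "\<And>g. g \<in> G \<Longrightarrow> blinfun_apply g y \<le> t"
  shows "Psi_DS G y = t"
  unfolding Psi_DS_def using assms by (intro Greatest_equality) auto

text \<open>A linear function on the triangle is maximal at a vertex; the three terms of the minimum
  belong to the three vertices.\<close>

lemma Psi_DS_triangle:
  assumes "0 \<le> a" "0 \<le> b"
  shows "Psi_DS triangle_functionals (- vector [a, b]) = - min (min a b) ((a + b) / 3)"
proof -
  have mem: "blinfun_inner_right p \<in> triangle_functionals"
    if "p \<in> {vector [1, 0], vector [0, 1], vector [1/3, 1/3]}" for p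
    unfolding triangle_functionals_def triangle_def using that by (intro imageI hull_inc)
  have le: "blinfun_apply g (- vector [a, b]) \<le> - min (min a b) ((a + b) / 3)"
    if "g \<in> triangle_functionals" for g
  proof -
    define m where "m = min (min a b) ((a + b) / 3)"
    obtain u v w where uvw: "0 \<le> u" "0 \<le> v" "0 \<le> w" "u + v + w = 1"
      and g: "g = blinfun_inner_right (vector [u + w / 3, v + w / 3])"
      using \<open>g \<in> _\<close> by (auto simp: triangle_functionals_def triangle_eq)
    have m: "m \<le> a" "m \<le> b" "m \<le> (a + b) / 3" unfolding m_def by linarith+
    have "u * m + v * m + w * m \<le> u * a + v * b + w * ((a + b) / 3)"
      using uvw by (intro add_mono mult_left_mono) (use m in simp_all)
    moreover have "u * m + v * m + w * m = m"
      using uvw(4) by (simp add: distrib_right[symmetric])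
    ultimately show ?thesis
      unfolding m_def[symmetric] g by (simp add: inner_vector algebra_simps add_divide_distrib)
  qed
  have "\<exists>f\<in>triangle_functionals. blinfun_apply f (- vector [a, b]) = - min (min a b) ((a + b) / 3)"
  proof -
    consider "min (min a b) ((a + b) / 3) = a" | "min (min a b) ((a + b) / 3) = b"
      | "min (min a b) ((a + b) / 3) = (a + b) / 3"
      by linarith
    then show ?thesis
    proof cases
      case 1
      then show ?thesis using mem by (intro bexI[of _ "blinfun_inner_right (vector [1, 0])"]) (auto simp: inner_vector)
    next
      case 2
      then show ?thesis using mem by (intro bexI[of _ "blinfun_inner_right (vector [0, 1])"]) (auto simp: inner_vector)
    next
      case 3
      then show ?thesis using mem by (intro bexI[of _ "blinfun_inner_right (vector [1/3, 1/3])"]) (auto simp: inner_vector)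
    qed
  qed
  then show ?thesis using le Psi_DS_eqI by blast
qed

text \<open>The support function is -1 at (-1, -2) and at (-2, -1), but -2/3 at (-1, -1). For an
  oriented distance, the first two values would force at most -1 at the third point.\<close>

lemma Psi_DS_triangle_notin_Omega_HU: "Psi_DS triangle_functionals \<notin> Omega_HU quadrant"
proof
  assume "Psi_DS triangle_functionals \<in> Omega_HU quadrant"
  then obtain N where N: "equivalent_norm N" and eq: "Psi_HU quadrant N = Psi_DS triangle_functionals"
    by (auto simp: Omega_HU_def)
  have iff: "c \<le> min (min s t) ((s + t) / 3) \<longleftrightarrow>
      (\<forall>a. - a \<notin> quadrant \<longrightarrow> c \<le> N (- vector [s, t] - a))" if "0 \<le> s" "0 \<le> t" for c s t
    using quadrant.Psi_HU_le_minus_iff[OF N, of "- vector [s, t]" c] that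
    unfolding eq Psi_DS_triangle[OF that] by (simp add: quadrant_def)
  \<comment> \<open>The complement of \<open>- quadrant\<close> is a union of two half-planes, each invariant under translation
    along one axis, so the distances from \<open>(-1, -2)\<close> and \<open>(-2, -1)\<close> control that from \<open>(-1, -1)\<close>.\<close>
  have "1 \<le> N (- vector [1, 1] - a)" if a: "- a \<notin> quadrant" for a
  proof (cases "a $ 1 > 0")
    case True
    have "- (a - vector [0, 1]) \<notin> quadrant" using True by (simp add: quadrant_def)
    then have "1 \<le> N (- vector [1, 2] - (a - vector [0, 1]))"
      using iff[of 1 2 1] by simp
    moreover have "- vector [1, 2] - (a - vector [0, 1]) = - vector [1, 1] - a"
      by (simp add: vec_eq_iff forall_2)
    ultimately show ?thesis by simp
  next
    case False
    then have "- (a - vector [1, 0]) \<notin> quadrant" using a by (simp add: quadrant_def)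
    then have "1 \<le> N (- vector [2, 1] - (a - vector [1, 0]))"
      using iff[of 2 1 1] by simp
    moreover have "- vector [2, 1] - (a - vector [1, 0]) = - vector [1, 1] - a"
      by (simp add: vec_eq_iff forall_2)
    ultimately show ?thesis by simp
  qed
  then show False using iff[of 1 1 1] by simp
qed

theorem corollary4p12:
  shows "(\<forall>K :: 'a::banach set. admissible K \<longrightarrow>
            Omega_GW K \<subseteq> Omega_HU K \<and> Omega_HU K \<subseteq> Omega_DS K) \<and>
         (\<exists>K :: (real^2) set. admissible K \<and>
            Omega_GW K \<subset> Omega_HU K \<and> Omega_HU K \<subset> Omega_DS K)"
proof (intro conjI allI impI)
  fix K :: "'a set" assume "admissible K"
  then interpret proper_cone K by (rule admissible_imp_proper_cone)
  show "Omega_GW K \<subseteq> Omega_HU K" by (rule Omega_GW_subset_Omega_HU)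
  show "Omega_HU K \<subseteq> Omega_DS K" by (rule Omega_HU_subset_Omega_DS)
next
  have "Psi_HU quadrant norm_l1 \<in> Omega_HU quadrant"
    using equivalent_norm_l1 by (auto simp: Omega_HU_def)
  with quadrant.Omega_GW_subset_Omega_HU Psi_HU_norm_l1_notin_Omega_GW
  have "Omega_GW quadrant \<subset> Omega_HU quadrant" by blast
  moreover have "Psi_DS triangle_functionals \<in> Omega_DS quadrant"
    using generator_triangle_functionals compactin_triangle_functionals by (auto simp: Omega_DS_def)
  with quadrant.Omega_HU_subset_Omega_DS Psi_DS_triangle_notin_Omega_HU
  have "Omega_HU quadrant \<subset> Omega_DS quadrant" by blast
  ultimately show "\<exists>K :: (real^2) set. admissible K \<and>
      Omega_GW K \<subset> Omega_HU K \<and> Omega_HU K \<subset> Omega_DS K"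
    using admissible_quadrant by blast
qed

end
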